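(* Let $|N|=n$, $|A|=m$, $L=m!$, and let the resolute rule $f:\mathcal L(A)^N\to A$ be given as a truth table, with preference comparisons precomputed (answerable in constant time). Then: (i) model checking a formula $\varphi$ of $\mathcal L_{\mathrm{bp}}(N,A)$ at all states of the biprofile model $\mathfrak M_f$ by direct enumeration takes time $O(|\varphi|L^{2n+d(\varphi)})$, where $d(\varphi)=\max\{|C|:\langle C\rangle\psi\text{ occurs in }\varphi\}$; (ii) strategy-proofness of $f$ can be checked by direct enumeration in time $O(nL^{n+1})$; (iii) strong group strategy-proofness of $f$ can be checked by direct enumeration in time $O(nL^n(1+L)^n)$.
   Context: $\mathcal L(A)$ is the set of strict linear orders on $A$ ($|\mathcal L(A)|=L$); $x\succ_i^Ry$ means $x$ above $y$ in $R_i$, $x\succeq_i^Ry$ means $x=y$ or $x\succ_i^Ry$; $Q\equiv_{-C}P$ means $Q_j=P_j$ for $j\notin C$. The biprofile model $\mathfrak M_f$ has states $(R,P)\in\mathcal L(A)^N\times\mathcal L(A)^N$, relations $(R,P)E_C(R',Q)$ iff $R'=R$ and $Q\equiv_{-C}P$, and atoms $o_x$ (true iff $f(P)=x$), $p^i_{xy}$ (true iff $x\succ_i^Ry$), $t^i_x$ (true iff $x$ is the top of $R_i$). $\mathcal L_{\mathrm{bp}}(N,A)$: $\varphi::=o_x\mid p^i_{xy}\mid t^i_x\mid\neg\varphi\mid\varphi\wedge\varphi\mid\langle C\rangle\varphi$, with $\langle C\rangle$ the diamond of $E_C$. $f$ is strategy-proof if $f(R)\succeq_i^Rf(Q)$ whenever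 $Q\equiv_{-\{i\}}R$; strongly group strategy-proof if there are no non-empty $C$, $R$, $Q\equiv_{-C}R$ with $f(Q)\succeq_i^Rf(R)$ for all $i\in C$ and strict for some $j\in C$. *)

theory Defs
  imports "HOL-Library.FuncSet" "HOL-Library.Monad_Syntax"
begin

section \<open>Profiles, rules and strategy-proofness\<close>

text \<open>\<open>(x, y) \<in> r\<close> means that \<open>x\<close> is ranked above \<open>y\<close>. The condition \<open>r \<subseteq> A \<times> A\<close> is needed
  because \<^const>\<open>strict_linear_order_on\<close> does not bound the field of \<open>r\<close>.\<close>

definition lin_orders :: "'a set \<Rightarrow> 'a rel set" where
  "lin_orders A = {r. r \<subseteq> A \<times> A \<and> strict_linear_order_on A r}"

definition profiles :: "'i set \<Rightarrow> 'a set \<Rightarrow> ('i \<Rightarrow> 'a rel) set" where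
  "profiles N A = (\<Pi>\<^sub>E i\<in>N. lin_orders A)"

definition weakly_above :: "'a rel \<Rightarrow> 'a \<Rightarrow> 'a \<Rightarrow> bool" where
  "weakly_above r x y \<longleftrightarrow> x = y \<or> (x, y) \<in> r"

definition agree_off :: "'i set \<Rightarrow> 'i set \<Rightarrow> ('i \<Rightarrow> 'a rel) \<Rightarrow> ('i \<Rightarrow> 'a rel) \<Rightarrow> bool" where
  "agree_off N C Q P \<longleftrightarrow> (\<forall>j\<in>N - C. Q j = P j)"

definition strategy_proof :: "'i set \<Rightarrow> 'a set \<Rightarrow> (('i \<Rightarrow> 'a rel) \<Rightarrow> 'a) \<Rightarrow> bool" where
  "strategy_proof N A f \<longleftrightarrow>
     (\<forall>i\<in>N. \<forall>R\<in>profiles N A. \<forall>Q\<in>profiles N A.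
        agree_off N {i} Q R \<longrightarrow> weakly_above (R i) (f R) (f Q))"

definition strongly_group_strategy_proof ::
    "'i set \<Rightarrow> 'a set \<Rightarrow> (('i \<Rightarrow> 'a rel) \<Rightarrow> 'a) \<Rightarrow> bool" where
  "strongly_group_strategy_proof N A f \<longleftrightarrow>
     \<not> (\<exists>C R Q. C \<noteq> {} \<and> C \<subseteq> N \<and> R \<in> profiles N A \<and> Q \<in> profiles N A \<and> agree_off N C Q R \<and>
          (\<forall>i\<in>C. weakly_above (R i) (f Q) (f R)) \<and> (\<exists>j\<in>C. (f Q, f R) \<in> R j))"


section \<open>The biprofile language and model\<close>

datatype ('i, 'a) fm =
    Out 'a
  | Pref 'i 'a 'a
  | Top 'i 'a
  | Neg "('i, 'a) fm"
  | Conj "('i, 'a) fm" "('i, 'a) fm"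
  | Dia "'i set" "('i, 'a) fm"

primrec wf_fm :: "'i set \<Rightarrow> 'a set \<Rightarrow> ('i, 'a) fm \<Rightarrow> bool" where
  "wf_fm N A (Out x) \<longleftrightarrow> x \<in> A"
| "wf_fm N A (Pref i x y) \<longleftrightarrow> i \<in> N \<and> x \<in> A \<and> y \<in> A"
| "wf_fm N A (Top i x) \<longleftrightarrow> i \<in> N \<and> x \<in> A"
| "wf_fm N A (Neg \<phi>) \<longleftrightarrow> wf_fm N A \<phi>"
| "wf_fm N A (Conj \<phi> \<psi>) \<longleftrightarrow> wf_fm N A \<phi> \<and> wf_fm N A \<psi>"
| "wf_fm N A (Dia C \<phi>) \<longleftrightarrow> C \<subseteq> N \<and> wf_fm N A \<phi>"

primrec subformulas :: "('i, 'a) fm \<Rightarrow> ('i, 'a) fm set" where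
  "subformulas (Out x) = {Out x}"
| "subformulas (Pref i x y) = {Pref i x y}"
| "subformulas (Top i x) = {Top i x}"
| "subformulas (Neg \<phi>) = insert (Neg \<phi>) (subformulas \<phi>)"
| "subformulas (Conj \<phi> \<psi>) = insert (Conj \<phi> \<psi>) (subformulas \<phi> \<union> subformulas \<psi>)"
| "subformulas (Dia C \<phi>) = insert (Dia C \<phi>) (subformulas \<phi>)"

text \<open>Every atom, connective and modality counts as one symbol, whatever the size of its
  coalition. Counting the members of coalitions as well would only weaken the bounds.\<close>

primrec fm_length :: "('i, 'a) fm \<Rightarrow> nat" where
  "fm_length (Out x) = 1"
| "fm_length (Pref i x y) = 1"
| "fm_length (Top i x) = 1"
| "fm_length (Neg \<phi>) = 1 + fm_length \<phi>"
| "fm_length (Conj \<phi> \<psi>) = 1 + fm_length \<phi> + fm_length \<psi>"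
| "fm_length (Dia C \<phi>) = 1 + fm_length \<phi>"

text \<open>The inserted \<open>0\<close> is the value for formulas without modalities.\<close>

definition max_coalition :: "('i, 'a) fm \<Rightarrow> nat" where
  "max_coalition \<phi> = Max (insert 0 {card C |C \<psi>. Dia C \<psi> \<in> subformulas \<phi>})"

type_synonym ('i, 'a) state = "('i \<Rightarrow> 'a rel) \<times> ('i \<Rightarrow> 'a rel)"

definition states :: "'i set \<Rightarrow> 'a set \<Rightarrow> ('i, 'a) state set" where
  "states N A = profiles N A \<times> profiles N A"

definition coalition_rel :: "'i set \<Rightarrow> 'a set \<Rightarrow> 'i set \<Rightarrow> ('i, 'a) state rel" where
  "coalition_rel N A C =
     {((R, P), (R', Q)) |R P R' Q.
        (R, P) \<in> states N A \<and> (R', Q) \<in> states N A \<and> R' = R \<and> agree_off N C Q P}"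

primrec sat ::
    "'i set \<Rightarrow> 'a set \<Rightarrow> (('i \<Rightarrow> 'a rel) \<Rightarrow> 'a) \<Rightarrow> ('i, 'a) state \<Rightarrow> ('i, 'a) fm \<Rightarrow> bool" where
  "sat N A f s (Out x) \<longleftrightarrow> f (snd s) = x"
| "sat N A f s (Pref i x y) \<longleftrightarrow> (x, y) \<in> fst s i"
| "sat N A f s (Top i x) \<longleftrightarrow> x \<in> A \<and> (\<forall>y\<in>A - {x}. (x, y) \<in> fst s i)"
| "sat N A f s (Neg \<phi>) \<longleftrightarrow> \<not> sat N A f s \<phi>"
| "sat N A f s (Conj \<phi> \<psi>) \<longleftrightarrow> sat N A f s \<phi> \<and> sat N A f s \<psi>"
| "sat N A f s (Dia C \<phi>) \<longleftrightarrow> (\<exists>s'. (s, s') \<in> coalition_rel N A C \<and> sat N A f s' \<phi>)"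


section \<open>Computations with a step counter\<close>

text \<open>Unit-cost model: a computation yields a value together with the number of elementary
  operations performed. An elementary operation is one arithmetic operation or comparison on
  numbers, one Boolean operation, one conditional selection, one list cell allocation, or one
  read or write of a table cell. Each of them is wrapped in \<open>tick\<close> below; loops are charged for
  every iteration and for the final exit test. Reading a variable or one of the numbers
  \<open>n\<close>, \<open>m\<close>, \<open>L\<close> is free.

  Tables filled during a computation are represented as functions. They are only ever updated in
  a single-threaded way, so an update stands for one array write; a freshly allocated table holds
  no information, and all its relevant cells are written before being read.\<close>

datatype 'a comp = Comp (val: 'a) (cost: nat)

definition tick :: "'a \<Rightarrow> 'a comp" where
  "tick x = Comp x 1"

definition bind_comp :: "'a comp \<Rightarrow> ('a \<Rightarrow> 'b comp) \<Rightarrow> 'b comp" where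
  "bind_comp c k = Comp (val (k (val c))) (cost c + cost (k (val c)))"

adhoc_overloading Monad_Syntax.bind \<rightleftharpoons> bind_comp

text \<open>\<open>for_lt k b\<close> runs \<open>b 0\<close>, \dots, \<open>b (k - 1)\<close> in this order, passing on an accumulator.\<close>

primrec for_lt :: "nat \<Rightarrow> (nat \<Rightarrow> 's \<Rightarrow> 's comp) \<Rightarrow> 's \<Rightarrow> 's comp" where
  "for_lt 0 b s = tick s"
| "for_lt (Suc k) b s = do { s' \<leftarrow> for_lt k b s; s'' \<leftarrow> tick s'; b k s'' }"

primrec for_list :: "'x list \<Rightarrow> ('x \<Rightarrow> 's \<Rightarrow> 's comp) \<Rightarrow> 's \<Rightarrow> 's comp" where
  "for_list [] b s = tick s"
| "for_list (x # xs) b s = do { s' \<leftarrow> tick s; s'' \<leftarrow> b x s'; for_list xs b s'' }"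


section \<open>Truth tables\<close>

text \<open>Voters are \<open>0, \<dots>, n - 1\<close>, alternatives are \<open>0, \<dots>, m - 1\<close>, and the \<open>L = m!\<close> linear orders
  are numbered \<open>0, \<dots>, L - 1\<close> by \<open>ix\<close>. A profile is addressed by the number whose \<open>i\<close>-th digit in
  base \<open>L\<close> is the number of the order of voter \<open>i\<close>; these are exactly the numbers below \<open>L ^ n\<close>.\<close>

record input =
  voters :: nat
  alts :: nat
  orders :: nat
  stride :: "nat \<Rightarrow> nat"
  outcome :: "nat \<Rightarrow> nat"
  prefers :: "nat \<Rightarrow> nat \<Rightarrow> nat \<Rightarrow> bool"

definition profile_index :: "nat \<Rightarrow> nat \<Rightarrow> (nat rel \<Rightarrow> nat) \<Rightarrow> (nat \<Rightarrow> nat rel) \<Rightarrow> nat" where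
  "profile_index n m ix P = (\<Sum>i<n. ix (P i) * fact m ^ i)"

text \<open>\<open>represents n m ix f T\<close>: the input \<open>T\<close> consists of \<open>n\<close>, \<open>m\<close>, \<open>L\<close>, the truth table of \<open>f\<close> with
  its strides (\<open>stride T n\<close> being the number of rows), and the table of preference comparisons.\<close>

definition represents ::
    "nat \<Rightarrow> nat \<Rightarrow> (nat rel \<Rightarrow> nat) \<Rightarrow> ((nat \<Rightarrow> nat rel) \<Rightarrow> nat) \<Rightarrow> input \<Rightarrow> bool" where
  "represents n m ix f T \<longleftrightarrow>
     bij_betw ix (lin_orders {..<m}) {..<fact m} \<and>
     voters T = n \<and> alts T = m \<and> orders T = fact m \<and>
     (\<forall>i\<le>n. stride T i = fact m ^ i) \<and>
     (\<forall>P\<in>profiles {..<n} {..<m}. outcome T (profile_index n m ix P) = f P) \<and>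
     (\<forall>r\<in>lin_orders {..<m}. \<forall>x<m. \<forall>y<m. prefers T (ix r) x y \<longleftrightarrow> (x, y) \<in> r)"

text \<open>The order number of voter \<open>i\<close> in profile \<open>p\<close>, and the profile obtained from \<open>p\<close> by giving
  order \<open>k\<close> to voter \<open>i\<close>.\<close>

definition digit :: "input \<Rightarrow> nat \<Rightarrow> nat \<Rightarrow> nat comp" where
  "digit T p i = do { w \<leftarrow> tick (stride T i); q \<leftarrow> tick (p div w); tick (q mod orders T) }"

definition set_digit :: "input \<Rightarrow> nat \<Rightarrow> nat \<Rightarrow> nat \<Rightarrow> nat comp" where
  "set_digit T p i k = do {
     w \<leftarrow> tick (stride T i);
     d \<leftarrow> digit T p i;
     u \<leftarrow> tick (d * w);
     v \<leftarrow> tick (k * w);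
     q \<leftarrow> tick (p - u);
     tick (q + v)
   }"

text \<open>\<open>for_deviations T C b p\<close> runs \<open>b q\<close> for every profile \<open>q\<close> that differs from \<open>p\<close> at most in the
  orders of the voters listed in \<open>C\<close>.\<close>

primrec for_deviations ::
    "input \<Rightarrow> nat list \<Rightarrow> (nat \<Rightarrow> 's \<Rightarrow> 's comp) \<Rightarrow> nat \<Rightarrow> 's \<Rightarrow> 's comp" where
  "for_deviations T [] b p s = b p s"
| "for_deviations T (i # C) b p s =
     for_lt (orders T) (\<lambda>k s. do { q \<leftarrow> set_digit T p i k; for_deviations T C b q s }) s"


section \<open>Model checking by direct enumeration\<close>

definition fill :: "input \<Rightarrow> (nat \<Rightarrow> nat \<Rightarrow> bool comp) \<Rightarrow> (nat \<times> nat \<Rightarrow> bool) comp" where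
  "fill T b = do {
     M \<leftarrow> tick (stride T (voters T));
     for_lt M (\<lambda>r. for_lt M (\<lambda>p tab. do { v \<leftarrow> b r p; tick (tab((r, p) := v)) })) (\<lambda>_. False)
   }"

text \<open>The top alternative of every linear order.\<close>

definition top_table :: "input \<Rightarrow> (nat \<Rightarrow> nat) comp" where
  "top_table T =
     for_lt (orders T) (\<lambda>k tab. do {
       t \<leftarrow> for_lt (alts T) (\<lambda>x best. do {
              b \<leftarrow> tick (prefers T k x best);
              tick (if b then x else best)
            }) 0;
       tick (tab(k := t))
     }) (\<lambda>_. 0)"

text \<open>The truth values of a formula at all states \<open>(r, p)\<close> are tabulated after those of its
  immediate subformulas. The members of the coalition of a modality are available as a list.
  If there is only one linear order, a coalition cannot deviate and its members are skipped:
  otherwise a state would be charged for \<open>|C|\<close> loops although it has a single successor.\<close>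

primrec model_check :: "input \<Rightarrow> (nat, nat) fm \<Rightarrow> (nat \<times> nat \<Rightarrow> bool) comp" where
  "model_check T (Out x) =
     fill T (\<lambda>r p. do { y \<leftarrow> tick (outcome T p); tick (y = x) })"
| "model_check T (Pref i x y) =
     fill T (\<lambda>r p. do { k \<leftarrow> digit T r i; tick (prefers T k x y) })"
| "model_check T (Top i x) = do {
     tops \<leftarrow> top_table T;
     fill T (\<lambda>r p. do { k \<leftarrow> digit T r i; y \<leftarrow> tick (tops k); tick (y = x) })
   }"
| "model_check T (Neg \<phi>) = do {
     a \<leftarrow> model_check T \<phi>;
     fill T (\<lambda>r p. do { u \<leftarrow> tick (a (r, p)); tick (\<not> u) })
   }"
| "model_check T (Conj \<phi> \<psi>) = do {
     a \<leftarrow> model_check T \<phi>;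
     b \<leftarrow> model_check T \<psi>;
     fill T (\<lambda>r p. do { u \<leftarrow> tick (a (r, p)); v \<leftarrow> tick (b (r, p)); tick (u \<and> v) })
   }"
| "model_check T (Dia C \<phi>) = do {
     a \<leftarrow> model_check T \<phi>;
     single \<leftarrow> tick (orders T = 1);
     D \<leftarrow> tick (if single then [] else sorted_list_of_set C);
     fill T (\<lambda>r p.
       for_deviations T D (\<lambda>q acc. do { v \<leftarrow> tick (a (r, q)); tick (acc \<or> v) }) p False)
   }"


section \<open>Checking strategy-proofness by direct enumeration\<close>

definition check_sp :: "input \<Rightarrow> bool comp" where
  "check_sp T = do {
     M \<leftarrow> tick (stride T (voters T));
     for_lt M (\<lambda>p ok. do {
       x \<leftarrow> tick (outcome T p);
       for_lt (voters T) (\<lambda>i ok. do {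
         k \<leftarrow> digit T p i;
         for_lt (orders T) (\<lambda>l ok. do {
           q \<leftarrow> set_digit T p i l;
           y \<leftarrow> tick (outcome T q);
           e \<leftarrow> tick (x = y);
           b \<leftarrow> tick (prefers T k x y);
           g \<leftarrow> tick (e \<or> b);
           tick (ok \<and> g)
         }) ok
       }) ok
     }) True
   }"

text \<open>All subsets of \<open>{0, \<dots>, k - 1}\<close> as lists.\<close>

primrec coalitions :: "nat \<Rightarrow> nat list list comp" where
  "coalitions 0 = tick [[]]"
| "coalitions (Suc k) = do {
     Cs \<leftarrow> coalitions k;
     for_list Cs (\<lambda>C Ds. do { C' \<leftarrow> tick (k # C); Es \<leftarrow> tick (C # Ds); tick (C' # Es) }) []
   }"

text \<open>Whether all members of \<open>C\<close> weakly gain and some member strictly gains when the profile \<open>p\<close>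
  is changed to \<open>q\<close>. This is false for \<open>C = []\<close>, so the empty coalition need not be excluded.\<close>

definition profitable :: "input \<Rightarrow> nat list \<Rightarrow> nat \<Rightarrow> nat \<Rightarrow> bool comp" where
  "profitable T C p q = do {
     x \<leftarrow> tick (outcome T p);
     y \<leftarrow> tick (outcome T q);
     e \<leftarrow> tick (y = x);
     (weak, strict) \<leftarrow> for_list C (\<lambda>i (weak, strict). do {
       k \<leftarrow> digit T p i;
       b \<leftarrow> tick (prefers T k y x);
       g \<leftarrow> tick (e \<or> b);
       weak' \<leftarrow> tick (weak \<and> g);
       strict' \<leftarrow> tick (strict \<or> b);
       tick (weak', strict')
     }) (True, False);
     tick (weak \<and> strict)
   }"

definition check_sgsp :: "input \<Rightarrow> bool comp" where
  "check_sgsp T = do {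
     M \<leftarrow> tick (stride T (voters T));
     Cs \<leftarrow> coalitions (voters T);
     for_lt M (\<lambda>p. for_list Cs (\<lambda>C. for_deviations T C (\<lambda>q ok. do {
       bad \<leftarrow> profitable T C p q;
       good \<leftarrow> tick (\<not> bad);
       tick (ok \<and> good)
     }) p)) True
   }"

end

theory Submission
  imports Defs
begin

text \<open>Running through the deviations of a coalition \<open>C\<close> costs \<open>O(L ^ |C|)\<close> iterations, since the loop
  overheads form a geometric series; for \<open>L = 1\<close>, where that series has \<open>|C|\<close> terms of equal size,
  the model checker skips the loops and the group check may pay a factor \<open>n\<close> anyway. Over the
  \<open>L ^ (2 n)\<close> states this gives the first bound. For the group check, the iterations summed over all
  coalitions number \<open>(\<Sum>C. L ^ |C|) = (1 + L) ^ n\<close> for each of the \<open>L ^ n\<close> profiles, and each of them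
  inspects at most \<open>n\<close> voters.\<close>

section \<open>Values and costs of loops\<close>

lemma val_tick [simp]: "val (tick x) = x"
  and cost_tick [simp]: "cost (tick x) = 1"
  by (simp_all add: tick_def)

lemma val_bind [simp]: "val (bind_comp c k) = val (k (val c))"
  and cost_bind [simp]: "cost (bind_comp c k) = cost c + cost (k (val c))"
  by (simp_all add: bind_comp_def)

text \<open>Taking \<open>e\<close> to be \<open>True\<close> or \<open>False\<close> covers loops computing a disjunction and
  loops computing a conjunction.\<close>

lemma val_for_lt_eq_iff:
  assumes "\<And>j s. j < k \<Longrightarrow> val (b j s) = e \<longleftrightarrow> s = e \<or> Q j"
  shows "val (for_lt k b s) = e \<longleftrightarrow> s = e \<or> (\<exists>j<k. Q j)"
  using assms by (induction k) (auto simp: less_Suc_eq)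

lemma val_for_list_eq_iff:
  assumes "\<And>x s. x \<in> set xs \<Longrightarrow> val (b x s) = e \<longleftrightarrow> s = e \<or> Q x"
  shows "val (for_list xs b s) = e \<longleftrightarrow> s = e \<or> (\<exists>x\<in>set xs. Q x)"
  using assms by (induction xs arbitrary: s) auto

lemma val_for_lt_table:
  "val (for_lt k (\<lambda>j tab. bind_comp (b j) (\<lambda>v. tick (tab(j := v)))) tab) j =
    (if j < k then val (b j) else tab j)"
  by (induction k) (auto simp: less_Suc_eq)

text \<open>Every cell is written in exactly one iteration. The fact \<open>row\<close> handles one
  inner loop: it changes only cells whose first coordinate is its own row number.\<close>

lemma val_for_lt_table2:
  fixes b :: "nat \<Rightarrow> nat \<Rightarrow> 'v comp"
  shows "val (for_lt k (\<lambda>r. for_lt M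
      (\<lambda>p tab. bind_comp (b r p) (\<lambda>v. tick (tab((r, p) := v))))) tab) (r, p) =
    (if r < k \<and> p < M then val (b r p) else tab (r, p))"
proof -
  have row: "val (for_lt M (\<lambda>p tab. bind_comp (b r' p) (\<lambda>v. tick (tab((r', p) := v)))) tab) (r, p) =
    (if r = r' \<and> p < M then val (b r p) else tab (r, p))" for r' tab
    by (induction M) (auto simp: less_Suc_eq)
  show ?thesis
    by (induction k) (auto simp: less_Suc_eq row simp del: fun_upd_apply)
qed

text \<open>The leading \<open>1\<close> pays for the exit test, the \<open>1\<close> next to
  \<open>B\<close> for the charge per iteration.\<close>

lemma cost_for_lt_le:
  assumes "\<And>j s. j < k \<Longrightarrow> cost (b j s) \<le> B"
  shows "cost (for_lt k b s) \<le> 1 + k * (B + 1)"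
  using assms
proof (induction k)
  case (Suc k)
  have "cost (for_lt k b s) \<le> 1 + k * (B + 1)"
    using Suc by simp
  moreover have "cost (b k (val (for_lt k b s))) \<le> B"
    using Suc.prems by simp
  ultimately show ?case
    by simp
qed simp

text \<open>The bound \<open>B\<close> may vary with the entry, because coalitions of different
  sizes have very different costs.\<close>

lemma cost_for_list_le:
  assumes "\<And>x s. x \<in> set xs \<Longrightarrow> cost (b x s) \<le> B x"
  shows "cost (for_list xs b s) \<le> 1 + (\<Sum>x\<leftarrow>xs. 1 + B x)"
  using assms
proof (induction xs arbitrary: s)
  case (Cons x xs)
  have "cost (for_list xs b (val (b x s))) \<le> 1 + (\<Sum>x\<leftarrow>xs. 1 + B x)"
    using Cons by simp
  moreover have "cost (b x s) \<le> B x"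
    using Cons.prems by simp
  ultimately show ?case
    by simp
qed simp

lemma cost_digit [simp]: "cost (digit T p i) = 3"
  by (simp add: digit_def)

lemma cost_set_digit [simp]: "cost (set_digit T p i k) = 8"
  by (simp add: set_digit_def)

text \<open>The \<open>9\<close> is \<open>8\<close> for \<open>set_digit\<close> plus the loop
  charge.\<close>

lemma cost_for_deviations_Cons_le:
  assumes "\<And>q s. cost (for_deviations T C b q s) \<le> B"
  shows "cost (for_deviations T (i # C) b p s) \<le> 1 + orders T * (B + 9)"
proof -
  have "cost (for_deviations T (i # C) b p s) \<le> 1 + orders T * ((8 + B) + 1)"
    unfolding for_deviations.simps using assms by (intro cost_for_lt_le) simp
  then show ?thesis
    by (simp add: algebra_simps)
qed

text \<open>The loop of a further voter adds an overhead of \<open>1 + 9 * L\<close>, at most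
  \<open>10\<close> times the new number of deviations; hence the term
  \<open>10 * length C\<close>.\<close>

lemma cost_for_deviations_le:
  assumes "orders T \<ge> 1" and "\<And>q s. cost (b q s) \<le> B"
  shows "cost (for_deviations T C b p s) \<le> (10 * length C + B) * orders T ^ length C"
proof (induction C arbitrary: p s)
  case (Cons i C)
  let ?L = "orders T" and ?k = "length C"
  have "cost (for_deviations T (i # C) b p s) \<le> 1 + ?L * ((10 * ?k + B) * ?L ^ ?k + 9)"
    by (rule cost_for_deviations_Cons_le) (rule Cons.IH)
  also have "\<dots> \<le> (10 * length (i # C) + B) * ?L ^ length (i # C)"
  proof -
    have "?L * 1 \<le> ?L * ?L ^ ?k"
      using assms(1) by (intro mult_left_mono) simp_all
    with assms(1) have "1 + 9 * ?L \<le> 10 * (?L * ?L ^ ?k)"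
      by linarith
    then show ?thesis
      by (simp add: algebra_simps)
  qed
  finally show ?case .
qed (use assms(2) in simp)

text \<open>With at least two orders the inner loops form a geometric series, and the factor
  \<open>length C\<close> of the preceding bound disappears.\<close>

lemma cost_for_deviations_le_geometric:
  assumes "orders T \<ge> 2" and "\<And>q s. cost (b q s) \<le> B"
  shows "cost (for_deviations T C b p s) + 19 \<le> (B + 19) * orders T ^ length C"
proof (induction C arbitrary: p s)
  case (Cons i C)
  let ?L = "orders T" and ?k = "length C"
  \<comment> \<open>The offset \<open>19\<close> turns the recurrence
    \<open>c' = 1 + L * (c + 9)\<close> into \<open>c' + 19 \<le> L * (c + 19)\<close>, which
    amounts to \<open>20 \<le> 10 * L\<close>. It is the least offset that works for
    \<open>L = 2\<close>.\<close>
  define K where "K = (B + 19) * ?L ^ ?k"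
  have K: "cost (for_deviations T C b q s) + 19 \<le> K" for q s
    using Cons.IH by (simp add: K_def)
  then have "K \<ge> 19"
    using add_leD2 by blast
  have "cost (for_deviations T (i # C) b p s) \<le> 1 + ?L * ((K - 19) + 9)"
  proof (rule cost_for_deviations_Cons_le)
    show "cost (for_deviations T C b q s) \<le> K - 19" for q s
      using K[of q s] by linarith
  qed
  also have "(K - 19) + 9 = K - 10"
    using \<open>K \<ge> 19\<close> by simp
  finally have "cost (for_deviations T (i # C) b p s) + 19 \<le> ?L * (K - 10) + 10 * ?L"
    using assms(1) by linarith
  also have "\<dots> = ?L * K"
    using \<open>K \<ge> 19\<close> by (simp add: diff_mult_distrib2)
  finally show ?case
    by (simp add: K_def mult.left_commute)
qed (use assms(2) in simp)


section \<open>Positional notation\<close>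

lemma sum_digits_less:
  fixes L :: nat
  assumes "\<And>i. i < n \<Longrightarrow> d i < L"
  shows "(\<Sum>i<n. d i * L ^ i) < L ^ n"
  using assms
proof (induction n)
  case (Suc n)
  have "(\<Sum>i<n. d i * L ^ i) < L ^ n"
    using Suc by simp
  moreover have "(d n + 1) * L ^ n \<le> L * L ^ n"
    using Suc.prems[of n] by (intro mult_right_mono) simp_all
  ultimately show ?case
    by simp
qed simp

lemma sum_digits_shift:
  fixes L :: nat
  shows "(\<Sum>i<Suc n. d i * L ^ i) = d 0 + L * (\<Sum>i<n. d (Suc i) * L ^ i)"
  unfolding sum.lessThan_Suc_shift by (simp add: sum_distrib_left mult.left_commute)

text \<open>Division by \<open>L\<close> drops the lowest digit and moves the others down one place,
  so the induction on \<open>i\<close> must let \<open>n\<close> and \<open>d\<close> vary.\<close>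

lemma sum_digits_div_mod:
  fixes L :: nat
  assumes "\<And>i. i < n \<Longrightarrow> d i < L" "i < n"
  shows "(\<Sum>i<n. d i * L ^ i) div L ^ i mod L = d i"
  using assms
proof (induction i arbitrary: n d)
  case 0
  then obtain k where "n = Suc k"
    by (cases n) auto
  with 0 show ?case
    by (simp add: sum_digits_shift del: sum.lessThan_Suc)
next
  case (Suc i)
  then obtain k where k: "n = Suc k"
    by (cases n) auto
  have "d 0 < L" "0 < L"
    using Suc.prems(1)[of 0] k by auto
  then have "(\<Sum>i<n. d i * L ^ i) div L = (\<Sum>i<k. d (Suc i) * L ^ i)"
    unfolding k sum_digits_shift by simp
  with Suc.IH[of k "\<lambda>i. d (Suc i)"] Suc.prems k show ?case
    by (simp add: div_mult2_eq)
qed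

lemma sum_div_mod_digits:
  fixes L :: nat
  assumes "p < L ^ n"
  shows "(\<Sum>i<n. (p div L ^ i mod L) * L ^ i) = p"
  using assms
proof (induction n arbitrary: p)
  case (Suc n)
  have "p div L < L ^ n"
    using Suc.prems by (intro less_mult_imp_div_less) (simp add: mult.commute)
  then have "(\<Sum>i<n. (p div L div L ^ i mod L) * L ^ i) = p div L"
    by (rule Suc.IH)
  then show ?case
    unfolding sum_digits_shift by (simp add: div_mult2_eq)
qed simp


section \<open>Truth tables of a rule\<close>

locale truth_table =
  fixes n m :: nat and ix :: "nat rel \<Rightarrow> nat" and f :: "(nat \<Rightarrow> nat rel) \<Rightarrow> nat" and T :: input
  assumes voters_pos: "n \<ge> 1"
    and rule: "f \<in> profiles {..<n} {..<m} \<rightarrow> {..<m}"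
    and representation: "represents n m ix f T"
begin

abbreviation "L \<equiv> fact m :: nat"
abbreviation "\<P> \<equiv> profiles {..<n} {..<m}"
abbreviation "idx \<equiv> profile_index n m ix"

lemma ix_bij: "bij_betw ix (lin_orders {..<m}) {..<L}"
  and voters [simp]: "voters T = n"
  and alts [simp]: "alts T = m"
  and orders [simp]: "orders T = L"
  and stride [simp]: "i \<le> n \<Longrightarrow> stride T i = L ^ i"
  and outcome [simp]: "P \<in> \<P> \<Longrightarrow> outcome T (idx P) = f P"
  and prefers [simp]:
    "\<lbrakk>r \<in> lin_orders {..<m}; x < m; y < m\<rbrakk> \<Longrightarrow> prefers T (ix r) x y \<longleftrightarrow> (x, y) \<in> r"
  using representation by (auto simp: represents_def)

lemma orders_pos: "1 \<le> L"
  by (simp add: fact_ge_1)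

lemma ix_less: "r \<in> lin_orders {..<m} \<Longrightarrow> ix r < L"
  using ix_bij by (auto simp: bij_betw_def)

text \<open>Translates what the loop lemmas say about order numbers back to orders.\<close>

lemma ex_less_orders_iff: "(\<exists>k<L. Q k) \<longleftrightarrow> (\<exists>r\<in>lin_orders {..<m}. Q (ix r))"
proof -
  have "{..<L} = ix ` lin_orders {..<m}"
    using ix_bij by (simp add: bij_betw_def)
  then have "(\<exists>k\<in>{..<L}. Q k) \<longleftrightarrow> (\<exists>r\<in>lin_orders {..<m}. Q (ix r))"
    by (simp only: bex_simps)
  then show ?thesis
    by (simp add: Bex_def)
qed

lemma profile_order: "P \<in> \<P> \<Longrightarrow> i < n \<Longrightarrow> P i \<in> lin_orders {..<m}"
  by (auto simp: profiles_def)

lemma profile_upd: "P \<in> \<P> \<Longrightarrow> i < n \<Longrightarrow> r \<in> lin_orders {..<m} \<Longrightarrow> P(i := r) \<in> \<P>"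
  by (auto simp: profiles_def PiE_def extensional_def)

lemma outcome_less [simp]: "P \<in> \<P> \<Longrightarrow> f P < m"
  using rule by auto

lemma idx_less: "P \<in> \<P> \<Longrightarrow> idx P < L ^ n"
  unfolding profile_index_def by (intro sum_digits_less ix_less profile_order)

lemma val_digit [simp]:
  assumes "P \<in> \<P>" "i < n"
  shows "val (digit T (idx P) i) = ix (P i)"
  using assms sum_digits_div_mod[of n "\<lambda>i. ix (P i)" L i]
  by (simp add: digit_def profile_index_def ix_less profile_order)

lemma val_set_digit [simp]:
  assumes "P \<in> \<P>" "i < n"
  shows "val (set_digit T (idx P) i (ix r)) = idx (P(i := r))"
proof -
  \<comment> \<open>With the summand of voter \<open>i\<close> isolated, the subtraction on naturals
    in \<open>set_digit\<close> is exact: it removes a summand that is present.\<close>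
  have "idx P = ix (P i) * L ^ i + (\<Sum>j\<in>{..<n} - {i}. ix (P j) * L ^ j)"
    and "idx (P(i := r)) = ix r * L ^ i + (\<Sum>j\<in>{..<n} - {i}. ix (P j) * L ^ j)"
    using assms(2) by (simp_all add: profile_index_def sum.remove[of "{..<n}" i])
  moreover have "val (set_digit T (idx P) i (ix r)) = idx P - ix (P i) * L ^ i + ix r * L ^ i"
    using assms by (simp add: set_digit_def)
  ultimately show ?thesis
    by simp
qed

lemma idx_surj:
  assumes "p < L ^ n"
  obtains P where "P \<in> \<P>" "idx P = p"
proof -
  \<comment> \<open>Decode \<open>p\<close> digit by digit; the restriction to \<open>{..<n}\<close>
    makes the result extensional, as membership in \<open>\<P>\<close> demands.\<close>
  define P where "P = (\<lambda>i\<in>{..<n}. inv_into (lin_orders {..<m}) ix (p div L ^ i mod L))"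
  have digit: "p div L ^ i mod L \<in> ix ` lin_orders {..<m}" for i
    using ix_bij by (simp add: bij_betw_def)
  have "P \<in> \<P>"
    by (auto simp: P_def profiles_def intro: inv_into_into digit)
  moreover have "idx P = p"
    using sum_div_mod_digits[OF assms]
    by (simp add: P_def profile_index_def f_inv_into_f[OF digit])
  ultimately show ?thesis
    by (rule that)
qed

lemma idx_inj:
  assumes "P \<in> \<P>" "Q \<in> \<P>" "idx P = idx Q"
  shows "P = Q"
proof -
  have "P i = Q i" if "i < n" for i
    using assms that ix_bij val_digit[of P i] val_digit[of Q i]
    by (auto simp: bij_betw_def inj_on_eq_iff profile_order)
  then show ?thesis
    using assms(1,2) unfolding profiles_def by (auto intro: PiE_ext)
qed

lemma ex_less_profiles_iff: "(\<exists>p<L ^ n. Q p) \<longleftrightarrow> (\<exists>P\<in>\<P>. Q (idx P))"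
proof -
  have "{..<L ^ n} = idx ` \<P>"
    by (auto intro: idx_less elim!: idx_surj)
  then have "(\<exists>p\<in>{..<L ^ n}. Q p) \<longleftrightarrow> (\<exists>P\<in>\<P>. Q (idx P))"
    by (simp only: bex_simps)
  then show ?thesis
    by (simp add: Bex_def)
qed

text \<open>A deviation of \<open>i # C\<close> is a change of voter \<open>i\<close> followed by a
  deviation of \<open>C\<close>, which gives an induction on the list. As before, \<open>e\<close>
  is \<open>True\<close> for searches and \<open>False\<close> for checks.\<close>

lemma val_for_deviations_eq_iff:
  assumes "\<And>Q s. Q \<in> \<P> \<Longrightarrow> val (b (idx Q) s) = e \<longleftrightarrow> s = e \<or> W Q"
    and "P \<in> \<P>" "set C \<subseteq> {..<n}"
  shows "val (for_deviations T C b (idx P) s) = e \<longleftrightarrow>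
    s = e \<or> (\<exists>Q\<in>\<P>. agree_off {..<n} (set C) Q P \<and> W Q)"
  using assms(2,3)
proof (induction C arbitrary: P s)
  case Nil
  have "Q = P" if "Q \<in> \<P>" "\<forall>j<n. Q j = P j" for Q
    using that Nil.prems(1) unfolding profiles_def by (auto intro: PiE_ext)
  then have "(\<exists>Q\<in>\<P>. agree_off {..<n} {} Q P \<and> W Q) \<longleftrightarrow> W P"
    using Nil.prems(1) by (auto simp: agree_off_def)
  then show ?case
    using assms(1) Nil.prems(1) by simp
next
  case (Cons i C)
  then have i: "i < n"
    by simp
  \<comment> \<open>The loop lemma wants a predicate on numbers, hence the detour through
    \<open>k = ix r\<close>; injectivity of \<open>ix\<close> then removes it.\<close>
  define V where "V k \<longleftrightarrow> (\<exists>r\<in>lin_orders {..<m}. k = ix r \<and>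
    (\<exists>Q\<in>\<P>. agree_off {..<n} (set C) Q (P(i := r)) \<and> W Q))" for k
  have V: "V (ix r) \<longleftrightarrow> (\<exists>Q\<in>\<P>. agree_off {..<n} (set C) Q (P(i := r)) \<and> W Q)"
    if "r \<in> lin_orders {..<m}" for r
    using that ix_bij by (auto simp: V_def bij_betw_def inj_on_eq_iff)
  have "val (for_deviations T (i # C) b (idx P) s) = e \<longleftrightarrow> s = e \<or> (\<exists>k<L. V k)"
    unfolding for_deviations.simps orders
  proof (rule val_for_lt_eq_iff)
    fix k s
    assume "k < L"
    then obtain r where r: "r \<in> lin_orders {..<m}" "k = ix r"
      using ix_bij by (auto simp: bij_betw_def)
    have "val (for_deviations T C b (idx (P(i := r))) s) = e \<longleftrightarrow> s = e \<or> V k"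
      unfolding r(2) V[OF r(1)] using Cons.prems i r(1) by (intro Cons.IH profile_upd) simp_all
    then show "val (bind_comp (set_digit T (idx P) i k) (\<lambda>q. for_deviations T C b q s)) = e \<longleftrightarrow>
      s = e \<or> V k"
      unfolding val_bind r(2) val_set_digit[OF Cons.prems(1) i] .
  qed
  also have "(\<exists>k<L. V k) \<longleftrightarrow>
    (\<exists>r\<in>lin_orders {..<m}. \<exists>Q\<in>\<P>. agree_off {..<n} (set C) Q (P(i := r)) \<and> W Q)"
    unfolding ex_less_orders_iff using V by blast
  also have "\<dots> \<longleftrightarrow> (\<exists>Q\<in>\<P>. agree_off {..<n} (set (i # C)) Q P \<and> W Q)" (is "?l \<longleftrightarrow> ?r")
  proof
    assume ?l
    then obtain r Q where Q: "Q \<in> \<P>" "W Q" and off: "agree_off {..<n} (set C) Q (P(i := r))"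
      by blast
    have "agree_off {..<n} (set (i # C)) Q P"
      using off by (auto simp: agree_off_def)
    with Q show ?r
      by blast
  next
    assume ?r
    then obtain Q where Q: "Q \<in> \<P>" "W Q" and off: "agree_off {..<n} (set (i # C)) Q P"
      by blast
    \<comment> \<open>To reach \<open>Q\<close>, the outer loop must pick the order that
      \<open>Q\<close> itself gives to voter \<open>i\<close>.\<close>
    have "agree_off {..<n} (set C) Q (P(i := Q i))"
      using off by (auto simp: agree_off_def)
    with Q profile_order[OF Q(1) i] show ?l
      by blast
  qed
  finally show ?case .
qed


section \<open>Model checking\<close>

lemma val_fill:
  assumes "r < L ^ n" "p < L ^ n"
  shows "val (fill T b) (r, p) = val (b r p)"
  using assms by (simp add: fill_def val_for_lt_table2)

lemma cost_fill_le:
  assumes "\<And>r p. cost (b r p) \<le> B"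
  shows "cost (fill T b) \<le> (B + 6) * L ^ (2 * n)"
proof -
  define M K where "M = L ^ n" and "K = M * M"
  have "cost (for_lt M (\<lambda>p tab. bind_comp (b r p) (\<lambda>v. tick (tab((r, p) := v)))) tab)
      \<le> 1 + M * ((B + 1) + 1)" for r tab
    by (rule cost_for_lt_le) (simp add: assms)
  then have "cost (fill T b) \<le> 1 + (1 + M * ((1 + M * ((B + 1) + 1)) + 1))"
    unfolding fill_def by (simp add: M_def[symmetric] del: One_nat_def) (rule cost_for_lt_le, simp)
  also have "\<dots> \<le> (B + 6) * K"
  proof -
    have "M \<le> K" "1 \<le> K"
      by (simp_all add: K_def M_def)
    moreover have "1 + (1 + M * ((1 + M * ((B + 1) + 1)) + 1)) = 2 + 2 * M + (B + 2) * K"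
      and "(B + 6) * K = 4 * K + (B + 2) * K"
      by (simp_all add: K_def algebra_simps)
    ultimately show ?thesis
      by simp
  qed
  also have "K = L ^ (2 * n)"
    by (simp add: K_def M_def mult_2 power_add)
  finally show ?thesis .
qed

text \<open>The scan takes about \<open>L * m\<close> steps. Since \<open>m \<le> m! = L\<close> and
  \<open>n \<ge> 1\<close>, this is within \<open>L ^ (2 * n)\<close>, so the precomputation costs
  no more than filling one table.\<close>

lemma cost_top_table_le: "cost (top_table T) \<le> 7 * L ^ (2 * n)"
proof -
  have inner: "cost (for_lt m (\<lambda>x best. bind_comp (tick (prefers T k x best))
      (\<lambda>b. tick (if b then x else best))) 0) \<le> 1 + m * (2 + 1)" for k
    by (rule cost_for_lt_le) simp
  have "cost (top_table T) \<le> 1 + L * ((1 + m * (2 + 1) + 1) + 1)"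
    unfolding top_table_def orders alts
    by (rule cost_for_lt_le, unfold cost_bind, intro add_mono inner) simp
  also have "\<dots> \<le> 7 * (L * L)"
  proof -
    have "L * m \<le> L * L" "L * 1 \<le> L * L"
      using fact_ge_self[of m] by (simp_all add: fact_ge_1)
    moreover have "1 + L * ((1 + m * (2 + 1) + 1) + 1) = 1 + 3 * L + 3 * (L * m)"
      by (simp add: algebra_simps)
    ultimately show ?thesis
      using orders_pos by linarith
  qed
  also have "L * L \<le> L ^ (2 * n)"
    using power_increasing[of 2 "2 * n" L] voters_pos orders_pos by (simp add: power2_eq_square)
  finally show ?thesis
    by simp
qed

lemma val_top_table:
  assumes "r \<in> lin_orders {..<m}" "x < m"
  shows "val (top_table T) (ix r) = x \<longleftrightarrow> (\<forall>y\<in>{..<m} - {x}. (x, y) \<in> r)"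
proof -
  have lin: "trans r" "irrefl r" "total_on {..<m} r"
    using assms(1) by (auto simp: lin_orders_def strict_linear_order_on_def)
  define best where "best k = val (for_lt k (\<lambda>x best. bind_comp (tick (prefers T (ix r) x best))
    (\<lambda>b. tick (if b then x else best))) 0)" for k
  have best_Suc: "best (Suc k) = (if prefers T (ix r) k (best k) then k else best k)" for k
    by (simp add: best_def)
  \<comment> \<open>Loop invariant: \<open>best k\<close> beats all other alternatives below
    \<open>k\<close>. The initial \<open>0\<close> is an alternative because \<open>x < m\<close>,
    and the first iteration compares it with itself.\<close>
  have best: "best k < m \<and> (\<forall>y<k. y \<noteq> best k \<longrightarrow> (best k, y) \<in> r)" if "k \<le> m" for k
    using that
  proof (induction k)
    case 0
    then show ?case
      using assms(2) by (simp add: best_def)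
  next
    case (Suc k)
    then have IH: "best k < m" "\<And>y. y < k \<Longrightarrow> y \<noteq> best k \<Longrightarrow> (best k, y) \<in> r" and k: "k < m"
      by auto
    show ?case
    proof (cases "(k, best k) \<in> r")
      case True
      then have "best (Suc k) = k"
        using IH k assms(1) by (simp add: best_Suc)
      then show ?thesis
        using IH True k lin(1) by (auto simp: less_Suc_eq dest: transD)
    next
      case False
      then have "best (Suc k) = best k"
        using IH k assms(1) by (simp add: best_Suc)
      then show ?thesis
        using IH False k lin(3) by (auto simp: less_Suc_eq total_on_def)
    qed
  qed
  have "val (top_table T) (ix r) = best m"
    using ix_less[OF assms(1)] unfolding top_table_def best_def
    by (simp add: val_for_lt_table[where b = "\<lambda>k. for_lt m (\<lambda>x best. bind_comp
      (tick (prefers T k x best)) (\<lambda>b. tick (if b then x else best))) 0"])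
  \<comment> \<open>Two distinct top alternatives would beat each other, against transitivity and
    irreflexivity.\<close>
  moreover have "best m = x \<longleftrightarrow> (\<forall>y\<in>{..<m} - {x}. (x, y) \<in> r)"
    using best[of m] assms(2) lin(1,2) unfolding irrefl_def
    by (metis DiffE DiffI insertI1 lessThan_iff order_refl singletonD transD)
  ultimately show ?thesis
    by simp
qed

text \<open>Justifies that the model checker skips the members of a coalition when
  \<open>L = 1\<close>.\<close>

lemma profiles_eq_if_one_order:
  assumes "L = 1" "P \<in> \<P>" "Q \<in> \<P>"
  shows "Q = P"
proof -
  have "Q i = P i" if "i < n" for i
    using ix_bij ix_less[OF profile_order[OF assms(2) that]]
      ix_less[OF profile_order[OF assms(3) that]] profile_order[OF assms(2) that]
      profile_order[OF assms(3) that] assms(1)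
    by (auto simp: bij_betw_def inj_on_def)
  then show ?thesis
    using assms(2,3) unfolding profiles_def by (auto intro: PiE_ext)
qed

text \<open>The induction varies \<open>P\<close> but keeps \<open>R\<close> fixed, since modalities
  move only the second profile of a state.\<close>

lemma val_model_check:
  assumes "wf_fm {..<n} {..<m} \<phi>" "R \<in> \<P>" "P \<in> \<P>"
  shows "val (model_check T \<phi>) (idx R, idx P) \<longleftrightarrow> sat {..<n} {..<m} f (R, P) \<phi>"
  using assms
proof (induction \<phi> arbitrary: P)
  case (Dia C \<phi>)
  then have C: "C \<subseteq> {..<n}" "finite C"
    by (auto intro: finite_subset)
  define D where "D = (if L = 1 then [] else sorted_list_of_set C)"
  have D: "set D \<subseteq> {..<n}"
    using C by (simp add: D_def)
  \<comment> \<open>Replacing \<open>C\<close> by the list actually enumerated does not change the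
    reachable profiles, even where that list is empty because \<open>L = 1\<close>.\<close>
  have off: "agree_off {..<n} (set D) Q P \<longleftrightarrow> agree_off {..<n} C Q P" if "Q \<in> \<P>" for Q
  proof (cases "L = 1")
    case True
    then have "Q = P"
      using Dia.prems that by (intro profiles_eq_if_one_order)
    then show ?thesis
      by (simp add: agree_off_def)
  next
    case False
    then show ?thesis
      using C by (simp add: D_def)
  qed
  have "val (model_check T (Dia C \<phi>)) (idx R, idx P) =
    val (for_deviations T D (\<lambda>q acc. bind_comp (tick (val (model_check T \<phi>) (idx R, q)))
      (\<lambda>v. tick (acc \<or> v))) (idx P) False)"
    using Dia.prems(2,3)
    unfolding model_check.simps val_bind val_tick orders D_def by (simp only: val_fill idx_less)
  moreover have "val (for_deviations T D (\<lambda>q acc.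
      bind_comp (tick (val (model_check T \<phi>) (idx R, q))) (\<lambda>v. tick (acc \<or> v))) (idx P) False) = True
    \<longleftrightarrow> False = True \<or>
      (\<exists>Q\<in>\<P>. agree_off {..<n} (set D) Q P \<and> sat {..<n} {..<m} f (R, Q) \<phi>)"
    using Dia by (intro val_for_deviations_eq_iff D) auto
  ultimately have "val (model_check T (Dia C \<phi>)) (idx R, idx P) \<longleftrightarrow>
      (\<exists>Q\<in>\<P>. agree_off {..<n} (set D) Q P \<and> sat {..<n} {..<m} f (R, Q) \<phi>)"
    by simp
  also have "\<dots> \<longleftrightarrow> sat {..<n} {..<m} f (R, P) (Dia C \<phi>)"
    using Dia.prems off by (auto simp: coalition_rel_def states_def)
  finally show ?case
    by simp
qed (auto simp: val_fill idx_less val_top_table profile_order)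

end

section \<open>The parameter d(phi) and the cost of model checking\<close>

lemma max_coalition_simps [simp]:
  fixes i :: 'i and x y :: 'a and \<phi> \<psi> :: "('i, 'a) fm"
  shows "max_coalition (Out x) = 0"
  "max_coalition (Pref i x y) = 0"
  "max_coalition (Top i x) = 0"
  "max_coalition (Neg \<phi>) = max_coalition \<phi>"
  "max_coalition (Conj \<phi> \<psi>) = max (max_coalition \<phi>) (max_coalition \<psi>)"
  "max_coalition (Dia C \<phi>) = max (card C) (max_coalition \<phi>)"
proof -
  let ?S = "\<lambda>\<phi> :: ('i, 'a) fm. {card C |C \<psi>. Dia C \<psi> \<in> subformulas \<phi>}"
  have fin: "finite (?S \<phi>)" for \<phi> :: "('i, 'a) fm"
  proof -
    have "finite (subformulas \<phi>)"
      by (induction \<phi>) simp_all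
    \<comment> \<open>\<open>Max\<close> behaves well only on finite sets; finiteness comes from an
      image of the finite set of subformulas, with \<open>0\<close> as default at other
      shapes.\<close>
    moreover have "?S \<phi> \<subseteq> (\<lambda>\<chi>. case \<chi> of Dia C \<psi> \<Rightarrow> card C | _ \<Rightarrow> 0) ` subformulas \<phi>"
      by force
    ultimately show ?thesis
      using finite_surj by blast
  qed
  show "max_coalition (Out x) = 0" "max_coalition (Pref i x y) = 0" "max_coalition (Top i x) = 0"
    "max_coalition (Neg \<phi>) = max_coalition \<phi>"
    by (simp_all add: max_coalition_def)
  have "insert 0 (?S (Conj \<phi> \<psi>)) = insert 0 (?S \<phi>) \<union> insert 0 (?S \<psi>)"
    by auto
  then show "max_coalition (Conj \<phi> \<psi>) = max (max_coalition \<phi>) (max_coalition \<psi>)"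
    using fin[of \<phi>] fin[of \<psi>] unfolding max_coalition_def by (simp only:) (subst Max_Un; simp)
  have "insert 0 (?S (Dia C \<phi>)) = insert (card C) (insert 0 (?S \<phi>))"
    by auto
  then show "max_coalition (Dia C \<phi>) = max (card C) (max_coalition \<phi>)"
    using fin[of \<phi>] unfolding max_coalition_def by simp
qed

context truth_table
begin

text \<open>Each symbol of the formula pays for one table. The modality dictates the constant:
  \<open>21 = 2 + 19\<close> per state from the geometric bound, \<open>6\<close> from
  \<open>fill\<close>, and \<open>2\<close> for choosing the list of members.\<close>

lemma cost_model_check_le:
  "cost (model_check T \<phi>) \<le> 29 * (fm_length \<phi> * L ^ (2 * n + max_coalition \<phi>))"
proof (induction \<phi>)
  case (Out x)
  have "cost (model_check T (Out x)) \<le> (2 + 6) * L ^ (2 * n)"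
    unfolding model_check.simps by (rule cost_fill_le) simp
  then show ?case
    by simp
next
  case (Pref i x y)
  have "cost (model_check T (Pref i x y)) \<le> (4 + 6) * L ^ (2 * n)"
    unfolding model_check.simps by (rule cost_fill_le) simp
  then show ?case
    by simp
next
  case (Top i x)
  have "cost (model_check T (Top i x)) \<le> 7 * L ^ (2 * n) + (5 + 6) * L ^ (2 * n)"
    unfolding model_check.simps cost_bind
    by (intro add_mono cost_top_table_le cost_fill_le) simp
  then show ?case
    by simp
next
  case (Neg \<phi>)
  define X where "X = L ^ (2 * n + max_coalition \<phi>)"
  have "L ^ (2 * n) \<le> X"
    unfolding X_def by (intro power_increasing) (simp_all add: fact_ge_1)
  moreover have "cost (model_check T (Neg \<phi>)) \<le> 29 * (fm_length \<phi> * X) + (2 + 6) * L ^ (2 * n)"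
    unfolding model_check.simps cost_bind
    using Neg by (intro add_mono cost_fill_le) (simp_all add: X_def)
  ultimately have "cost (model_check T (Neg \<phi>)) \<le> 29 * ((1 + fm_length \<phi>) * X)"
    by (simp add: algebra_simps del: model_check.simps)
  then show ?case
    by (simp add: X_def)
next
  case (Conj \<phi> \<psi>)
  define X where "X = L ^ (2 * n + max (max_coalition \<phi>) (max_coalition \<psi>))"
  have le: "L ^ (2 * n) \<le> X" "L ^ (2 * n + max_coalition \<phi>) \<le> X"
    "L ^ (2 * n + max_coalition \<psi>) \<le> X"
    unfolding X_def by (intro power_increasing; simp add: fact_ge_1)+
  have "cost (model_check T \<phi>) \<le> 29 * (fm_length \<phi> * X)"
    by (intro order.trans[OF Conj.IH(1)] mult_left_mono le) simp_all
  moreover have "cost (model_check T \<psi>) \<le> 29 * (fm_length \<psi> * X)"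
    by (intro order.trans[OF Conj.IH(2)] mult_left_mono le) simp_all
  moreover have "cost (model_check T (Conj \<phi> \<psi>)) \<le>
    cost (model_check T \<phi>) + (cost (model_check T \<psi>) + (3 + 6) * L ^ (2 * n))"
    unfolding model_check.simps cost_bind by (intro add_mono cost_fill_le) simp_all
  ultimately have "cost (model_check T (Conj \<phi> \<psi>)) \<le>
      29 * ((1 + fm_length \<phi> + fm_length \<psi>) * X)"
    using le(1) by (simp add: algebra_simps del: model_check.simps)
  then show ?case
    by (simp add: X_def)
next
  case (Dia C \<phi>)
  define X where "X = L ^ (2 * n + max (card C) (max_coalition \<phi>))"
  have le: "L ^ (2 * n) * L ^ card C \<le> X" "L ^ (2 * n + max_coalition \<phi>) \<le> X"
    unfolding X_def power_add[symmetric] by (intro power_increasing; simp add: fact_ge_1)+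
  have "1 \<le> X"
    by (simp add: X_def)
  define D where "D = (if L = 1 then [] else sorted_list_of_set C)"
  have IH: "cost (model_check T \<phi>) \<le> 29 * (fm_length \<phi> * X)"
    by (intro order.trans[OF Dia.IH] mult_left_mono le) simp_all
  have dev: "cost (for_deviations T D b p s) \<le> 21 * L ^ card C"
    if "\<And>q s. cost (b q s) \<le> 2" for b :: "nat \<Rightarrow> bool \<Rightarrow> bool comp" and p s
  proof (cases "L = 1")
    case True
    then show ?thesis
      using that[of p s] by (simp add: D_def)
  next
    case False
    then have "L \<ge> 2"
      using orders_pos by linarith
    then have "cost (for_deviations T D b p s) + 19 \<le> (2 + 19) * L ^ length D"
      using cost_for_deviations_le_geometric[of T b 2 D p s] that by simp
    then show ?thesis
      \<comment> \<open>\<open>length D = card C\<close> also for infinite \<open>C\<close>, where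
        both are \<open>0\<close>.\<close>
      using False by (simp add: D_def)
  qed
  have "cost (model_check T (Dia C \<phi>)) \<le>
    29 * (fm_length \<phi> * X) + (1 + (1 + (21 * L ^ card C + 6) * L ^ (2 * n)))"
    unfolding model_check.simps cost_bind val_tick orders cost_tick D_def[symmetric]
    by (intro add_mono IH cost_fill_le dev order_refl) simp
  also have "(21 * L ^ card C + 6) * L ^ (2 * n) \<le> 27 * X"
  proof -
    have "(21 * L ^ card C + 6) * L ^ (2 * n) \<le> (27 * L ^ card C) * L ^ (2 * n)"
      by (intro mult_right_mono) (simp_all add: Suc_leI)
    also have "\<dots> \<le> 27 * X"
      using le(1) by (simp add: mult.commute)
    finally show ?thesis .
  qed
  finally have "cost (model_check T (Dia C \<phi>)) \<le> 29 * ((1 + fm_length \<phi>) * X)"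
    using \<open>1 \<le> X\<close> by (simp add: algebra_simps del: model_check.simps)
  then show ?case
    by (simp add: X_def)
qed


section \<open>Strategy-proofness\<close>

text \<open>Links the single-voter updates that the check enumerates with the agreement condition in
  \<open>strategy_proof\<close>; the order needed for a given \<open>Q\<close> is
  \<open>Q i\<close>.\<close>

lemma ex_profile_agree_off_single_iff:
  assumes "P \<in> \<P>" "i < n"
  shows "(\<exists>Q\<in>\<P>. agree_off {..<n} {i} Q P \<and> W Q) \<longleftrightarrow> (\<exists>r\<in>lin_orders {..<m}. W (P(i := r)))"
proof
  assume "\<exists>Q\<in>\<P>. agree_off {..<n} {i} Q P \<and> W Q"
  then obtain Q where Q: "Q \<in> \<P>" "W Q" "agree_off {..<n} {i} Q P"
    by blast
  then have "Q j = (P(i := Q i)) j" if "j < n" for j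
    using that by (simp add: agree_off_def)
  then have "Q = P(i := Q i)"
    using Q(1) profile_upd[OF assms profile_order[OF Q(1) assms(2)]]
    unfolding profiles_def by (intro PiE_ext) auto
  then show "\<exists>r\<in>lin_orders {..<m}. W (P(i := r))"
    using Q(2) profile_order[OF Q(1) assms(2)] by metis
next
  assume "\<exists>r\<in>lin_orders {..<m}. W (P(i := r))"
  then obtain r where "r \<in> lin_orders {..<m}" "W (P(i := r))"
    by blast
  moreover have "agree_off {..<n} {i} (P(i := r)) P"
    by (simp add: agree_off_def)
  ultimately show "\<exists>Q\<in>\<P>. agree_off {..<n} {i} Q P \<and> W Q"
    using profile_upd[OF assms] by blast
qed

lemma val_check_sp: "val (check_sp T) \<longleftrightarrow> strategy_proof {..<n} {..<m} f"
proof -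
  \<comment> \<open>Stated on indices, so that the loop lemma can be applied to all three nested
    loops before anything is decoded.\<close>
  define bad where "bad p i l \<longleftrightarrow> (let q = val (set_digit T p i l) in
    outcome T p \<noteq> outcome T q \<and> \<not> prefers T (val (digit T p i)) (outcome T p) (outcome T q))"
    for p i l
  have bad: "bad (idx P) i (ix r) \<longleftrightarrow> \<not> weakly_above (P i) (f P) (f (P(i := r)))"
    if "P \<in> \<P>" "i < n" "r \<in> lin_orders {..<m}" for P i r
    using that by (simp add: bad_def weakly_above_def profile_upd profile_order)
  have "val (check_sp T) = False \<longleftrightarrow> True = False \<or> (\<exists>p<L ^ n. \<exists>i<n. \<exists>l<L. bad p i l)"
    unfolding check_sp_def val_bind val_tick voters orders stride[OF order_refl]
    by (rule val_for_lt_eq_iff, unfold val_bind val_tick, rule val_for_lt_eq_iff,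
      unfold val_bind val_tick, rule val_for_lt_eq_iff) (auto simp: bad_def Let_def)
  also have "\<dots> \<longleftrightarrow> (\<exists>P\<in>\<P>. \<exists>i<n. \<exists>r\<in>lin_orders {..<m}.
      \<not> weakly_above (P i) (f P) (f (P(i := r))))"
    unfolding ex_less_profiles_iff ex_less_orders_iff by (simp add: bad cong: bex_cong conj_cong)
  also have "\<dots> \<longleftrightarrow> (\<exists>P\<in>\<P>. \<exists>i<n. \<exists>Q\<in>\<P>. agree_off {..<n} {i} Q P \<and>
      \<not> weakly_above (P i) (f P) (f Q))"
    by (simp add: ex_profile_agree_off_single_iff cong: bex_cong conj_cong)
  also have "\<dots> \<longleftrightarrow> \<not> strategy_proof {..<n} {..<m} f"
    by (auto simp: strategy_proof_def)
  finally show ?thesis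
    by simp
qed

lemma cost_check_sp_le: "cost (check_sp T) \<le> 24 * (n * L ^ (n + 1))"
proof -
  define M where "M = L ^ n"
  have "cost (check_sp T) \<le> 1 + (1 + M * ((1 + (1 + n * ((3 + (1 + L * (13 + 1))) + 1))) + 1))"
    unfolding check_sp_def cost_bind cost_tick cost_digit val_tick voters orders
      stride[OF order_refl] M_def
    by (intro add_mono order_refl cost_for_lt_le,
      unfold cost_bind cost_tick cost_digit, intro add_mono order_refl cost_for_lt_le,
      unfold cost_bind cost_tick cost_digit, intro add_mono order_refl cost_for_lt_le) simp
  also have "\<dots> \<le> 24 * (n * M * L)"
  proof -
    \<comment> \<open>Since \<open>n\<close>, \<open>M\<close> and \<open>L\<close> are positive,
      every lower-order term is absorbed: \<open>24 = 2 + 3 + 5 + 14\<close>.\<close>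
    have "1 \<le> n * M * L" "M \<le> n * M * L" "n * M \<le> n * M * L"
      using voters_pos orders_pos by (simp_all add: M_def)
    moreover have "1 + (1 + M * ((1 + (1 + n * ((3 + (1 + L * (13 + 1))) + 1))) + 1)) =
        2 + 3 * M + 5 * (n * M) + 14 * (n * M * L)"
      by (simp add: algebra_simps)
    ultimately show ?thesis
      by linarith
  qed
  finally show ?thesis
    by (simp add: M_def mult_ac)
qed

end

section \<open>Enumeration of coalitions and strong group strategy-proofness\<close>

lemma set_val_coalitions_Suc:
  "set (val (coalitions (Suc k))) = set (val (coalitions k)) \<union> (#) k ` set (val (coalitions k))"
proof -
  have "set (val (for_list Cs (\<lambda>C Ds. bind_comp (tick (k # C)) (\<lambda>C'.
      bind_comp (tick (C # Ds)) (\<lambda>Es. tick (C' # Es)))) Ds)) =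
    set Ds \<union> set Cs \<union> (#) k ` set Cs" for Cs Ds
    by (induction Cs arbitrary: Ds) auto
  then show ?thesis
    by simp
qed

lemma set_val_coalitions: "set ` set (val (coalitions k)) = Pow {..<k}"
proof (induction k)
  case (Suc k)
  have "set ` set (val (coalitions (Suc k))) = Pow {..<k} \<union> insert k ` Pow {..<k}"
    by (simp add: set_val_coalitions_Suc image_Un image_image Suc.IH[symmetric]
      del: coalitions.simps)
  then show ?case
    by (simp add: lessThan_Suc Pow_insert)
qed simp

lemma length_coalition_le: "C \<in> set (val (coalitions k)) \<Longrightarrow> length C \<le> k"
proof (induction k arbitrary: C)
  case (Suc k)
  then show ?case
    unfolding set_val_coalitions_Suc by fastforce
qed simp

text \<open>Each list \<open>C\<close> survives and also spawns \<open>k # C\<close>, so every stage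
  multiplies the sum by \<open>1 + x\<close>. Taking \<open>x = L\<close> counts all deviations of
  all coalitions, \<open>x = 1\<close> the coalitions themselves.\<close>

lemma sum_coalitions_power: "(\<Sum>C\<leftarrow>val (coalitions k). (x::nat) ^ length C) = (1 + x) ^ k"
proof (induction k)
  case (Suc k)
  have "(\<Sum>C\<leftarrow>val (for_list Cs (\<lambda>C Ds. bind_comp (tick (k # C)) (\<lambda>C'.
      bind_comp (tick (C # Ds)) (\<lambda>Es. tick (C' # Es)))) Ds). x ^ length C) =
    (\<Sum>C\<leftarrow>Ds. x ^ length C) + (1 + x) * (\<Sum>C\<leftarrow>Cs. x ^ length C)" for Cs Ds
    by (induction Cs arbitrary: Ds) (auto simp: algebra_simps)
  with Suc show ?case
    by simp
qed simp

lemma length_coalitions: "length (val (coalitions k)) = 2 ^ k"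
  using sum_coalitions_power[of 1 k, unfolded one_add_one] by (simp add: sum_list_triv)

lemma cost_coalitions_le: "cost (coalitions k) \<le> 5 * 2 ^ k"
proof -
  have "cost (for_list Cs (\<lambda>C Ds. bind_comp (tick (k # C)) (\<lambda>C'.
      bind_comp (tick (C # Ds)) (\<lambda>Es. tick (C' # Es)))) Ds) = 1 + 4 * length Cs"
    for k :: nat and Cs Ds
    by (induction Cs arbitrary: Ds) auto
  \<comment> \<open>Exact solution of the recurrence in which stage \<open>k\<close> adds
    \<open>1 + 4 * 2 ^ k\<close>.\<close>
  then have "cost (coalitions k) + 3 = 4 * 2 ^ k + k"
    by (induction k) (simp_all add: length_coalitions)
  moreover have "k < 2 ^ k"
    by (rule less_exp)
  ultimately show ?thesis
    by linarith
qed

context truth_table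
begin

lemma cost_profitable_le: "cost (profitable T C p q) \<le> 5 + 9 * length C"
proof -
  have "cost (for_list C (\<lambda>i s. case s of (weak, strict) \<Rightarrow> bind_comp (digit T p i) (\<lambda>k.
      bind_comp (tick (prefers T k y x)) (\<lambda>b. bind_comp (tick (e \<or> b)) (\<lambda>g.
      bind_comp (tick (weak \<and> g)) (\<lambda>weak'. bind_comp (tick (strict \<or> b)) (\<lambda>strict'.
      tick (weak', strict'))))))) s) \<le> 1 + (\<Sum>i\<leftarrow>C. 1 + 8)" for x y e s
    by (rule cost_for_list_le) (simp split: prod.split)
  then show ?thesis
    by (simp add: profitable_def sum_list_triv mult.commute split: prod.split)
qed

lemma val_profitable:
  assumes "P \<in> \<P>" "Q \<in> \<P>" "set C \<subseteq> {..<n}"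
  shows "val (profitable T C (idx P) (idx Q)) \<longleftrightarrow>
    (\<forall>i\<in>set C. weakly_above (P i) (f Q) (f P)) \<and> (\<exists>j\<in>set C. (f Q, f P) \<in> P j)"
proof -
  have "val (for_list C (\<lambda>i s. case s of (weak, strict) \<Rightarrow> bind_comp (digit T (idx P) i) (\<lambda>k.
      bind_comp (tick (prefers T k (f Q) (f P))) (\<lambda>b. bind_comp (tick (f Q = f P \<or> b)) (\<lambda>g.
      bind_comp (tick (weak \<and> g)) (\<lambda>weak'. bind_comp (tick (strict \<or> b)) (\<lambda>strict'.
      tick (weak', strict'))))))) (w, s)) =
    (w \<and> (\<forall>i\<in>set C. weakly_above (P i) (f Q) (f P)), s \<or> (\<exists>j\<in>set C. (f Q, f P) \<in> P j))"
    for w s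
    using assms by (induction C arbitrary: w s) (auto simp: profile_order weakly_above_def)
  then show ?thesis
    using assms by (simp add: profitable_def)
qed

lemma val_check_sgsp: "val (check_sgsp T) \<longleftrightarrow> strongly_group_strategy_proof {..<n} {..<m} f"
proof -
  define gain where "gain C P Q \<longleftrightarrow>
    (\<forall>i\<in>C. weakly_above (P i) (f Q) (f P)) \<and> (\<exists>j\<in>C. (f Q, f P) \<in> P j)" for C P Q
  define bad where "bad C P \<longleftrightarrow> (\<exists>Q\<in>\<P>. agree_off {..<n} C Q P \<and> gain C P Q)" for C P
  let ?Cs = "val (coalitions n)"
  have sub: "set C \<subseteq> {..<n}" if "C \<in> set ?Cs" for C
    using that set_val_coalitions[of n] by blast
  have "val (check_sgsp T) = False \<longleftrightarrow>
    True = False \<or> (\<exists>p<L ^ n. \<exists>C\<in>set ?Cs. \<exists>P\<in>\<P>. idx P = p \<and> bad (set C) P)"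
    unfolding check_sgsp_def val_bind val_tick voters stride[OF order_refl]
  proof (intro val_for_lt_eq_iff val_for_list_eq_iff)
    fix p C s
    assume "p < L ^ n" "C \<in> set ?Cs"
    then obtain P where P: "P \<in> \<P>" "idx P = p" and C: "set C \<subseteq> {..<n}"
      using idx_surj sub by metis
    have "val (for_deviations T C (\<lambda>q ok. bind_comp (profitable T C p q)
        (\<lambda>bad. bind_comp (tick (\<not> bad)) (\<lambda>good. tick (ok \<and> good)))) (idx P) s) = False \<longleftrightarrow>
      s = False \<or> bad (set C) P"
      unfolding bad_def using P C
      by (intro val_for_deviations_eq_iff) (auto simp: val_profitable gain_def)
    moreover have "Q = P" if "Q \<in> \<P>" "idx Q = p" for Q
      using that P by (simp add: idx_inj)
    ultimately show "val (for_deviations T C (\<lambda>q ok. bind_comp (profitable T C p q)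
        (\<lambda>bad. bind_comp (tick (\<not> bad)) (\<lambda>good. tick (ok \<and> good)))) p s) = False \<longleftrightarrow>
      s = False \<or> (\<exists>P\<in>\<P>. idx P = p \<and> bad (set C) P)"
      using P by blast
  qed
  also have "\<dots> \<longleftrightarrow> (\<exists>C\<in>set ` set ?Cs. \<exists>P\<in>\<P>. bad C P)"
    using idx_less by auto
  \<comment> \<open>\<open>Pow {..<n}\<close> contains the empty coalition, but \<open>gain\<close>
    demands a strict gainer among the members, so any witness is non-empty.\<close>
  also have "\<dots> \<longleftrightarrow> \<not> strongly_group_strategy_proof {..<n} {..<m} f"
    unfolding set_val_coalitions strongly_group_strategy_proof_def bad_def gain_def by blast
  finally show ?thesis
    by simp
qed

lemma cost_check_sgsp_le: "cost (check_sgsp T) \<le> 36 * (n * L ^ n * (1 + L) ^ n)"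
proof -
  define M where "M = L ^ n"
  let ?Cs = "val (coalitions n)" and ?S = "(1 + L) ^ n"
  define body where "body p C = for_deviations T C (\<lambda>q ok. bind_comp (profitable T C p q)
    (\<lambda>bad. bind_comp (tick (\<not> bad)) (\<lambda>good. tick (ok \<and> good)))) p" for p C
  \<comment> \<open>\<open>26 = 10 + 9 + 7\<close>, from \<open>length C \<le> n\<close> and
    \<open>n \<ge> 1\<close>.\<close>
  have dev: "cost (body p C s) \<le> 26 * n * L ^ length C" if "C \<in> set ?Cs" for p C s
  proof -
    have len: "length C \<le> n"
      using that by (rule length_coalition_le)
    have "cost (body p C s) \<le> (10 * length C + (7 + 9 * n)) * orders T ^ length C"
      unfolding body_def
    proof (rule cost_for_deviations_le)
      show "cost (bind_comp (profitable T C p q)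
        (\<lambda>bad. bind_comp (tick (\<not> bad)) (\<lambda>good. tick (ok \<and> good)))) \<le> 7 + 9 * n" for q ok
        using cost_profitable_le[of C p q] len by simp
    qed simp
    also have "\<dots> \<le> 26 * n * L ^ length C"
      using len voters_pos by simp
    finally show ?thesis .
  qed
  have loop: "cost (for_list ?Cs (body p) s) \<le> 1 + 27 * n * ?S" for p s
  proof -
    have "cost (for_list ?Cs (body p) s) \<le> 1 + (\<Sum>C\<leftarrow>?Cs. 1 + 26 * n * L ^ length C)"
      by (rule cost_for_list_le) (rule dev)
    also have "(\<Sum>C\<leftarrow>?Cs. 1 + 26 * n * L ^ length C) \<le> (\<Sum>C\<leftarrow>?Cs. 27 * n * L ^ length C)"
    proof (rule sum_list_mono)
      fix C :: "nat list"
      have "1 \<le> n * L ^ length C"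
        using voters_pos by simp
      then show "1 + 26 * n * L ^ length C \<le> 27 * n * L ^ length C"
        by simp
    qed
    also have "\<dots> = 27 * n * ?S"
      by (simp only: sum_list_const_mult sum_coalitions_power)
    finally show ?thesis
      by simp
  qed
  have "cost (check_sgsp T) \<le> 1 + (5 * 2 ^ n + (1 + M * ((1 + 27 * n * ?S) + 1)))"
    unfolding check_sgsp_def cost_bind cost_tick val_tick voters stride[OF order_refl] M_def
      body_def[symmetric]
    by (intro add_mono order_refl cost_for_lt_le cost_coalitions_le loop)
  also have "\<dots> \<le> 36 * (n * M * ?S)"
  proof -
    have M: "1 \<le> M"
      by (simp add: M_def)
    \<comment> \<open>As \<open>L \<ge> 1\<close>, listing the coalitions is no dearer than running
      through their deviations. In the end \<open>36 = 2 + 5 + 2 + 27\<close>.\<close>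
    have "2 ^ n \<le> ?S"
      using orders_pos by (intro power_mono) simp_all
    moreover have "?S \<le> n * M * ?S" "1 \<le> ?S" "M \<le> n * M * ?S"
      using voters_pos M by simp_all
    ultimately have "1 \<le> n * M * ?S" "2 ^ n \<le> n * M * ?S" "M \<le> n * M * ?S"
      by linarith+
    moreover have "1 + (5 * 2 ^ n + (1 + M * ((1 + 27 * n * ?S) + 1))) =
      2 + 5 * 2 ^ n + 2 * M + 27 * (n * M * ?S)"
      by (simp add: algebra_simps)
    ultimately show ?thesis
      by linarith
  qed
  finally show ?thesis
    by (simp add: M_def)
qed

end

theorem theorem5:
  shows
    "(\<exists>c::nat. \<forall>n m ix f T \<phi>.
        n \<ge> 1 \<longrightarrow> f \<in> profiles {..<n} {..<m} \<rightarrow> {..<m} \<longrightarrow> represents n m ix f T \<longrightarrow>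
        wf_fm {..<n} {..<m} \<phi> \<longrightarrow>
          (\<forall>(R, P)\<in>states {..<n} {..<m}.
             val (model_check T \<phi>) (profile_index n m ix R, profile_index n m ix P) \<longleftrightarrow>
             sat {..<n} {..<m} f (R, P) \<phi>) \<and>
          cost (model_check T \<phi>) \<le> c * (fm_length \<phi> * fact m ^ (2 * n + max_coalition \<phi>))) \<and>
     (\<exists>c::nat. \<forall>n m ix f T.
        n \<ge> 1 \<longrightarrow> f \<in> profiles {..<n} {..<m} \<rightarrow> {..<m} \<longrightarrow> represents n m ix f T \<longrightarrow>
          (val (check_sp T) \<longleftrightarrow> strategy_proof {..<n} {..<m} f) \<and>
          cost (check_sp T) \<le> c * (n * fact m ^ (n + 1))) \<and>
     (\<exists>c::nat. \<forall>n m ix f T.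
        n \<ge> 1 \<longrightarrow> f \<in> profiles {..<n} {..<m} \<rightarrow> {..<m} \<longrightarrow> represents n m ix f T \<longrightarrow>
          (val (check_sgsp T) \<longleftrightarrow> strongly_group_strategy_proof {..<n} {..<m} f) \<and>
          cost (check_sgsp T) \<le> c * (n * fact m ^ n * (1 + fact m) ^ n))"
proof (intro conjI exI allI impI)
  fix n m ix f T and \<phi> :: "(nat, nat) fm"
  assume "n \<ge> 1" "f \<in> profiles {..<n} {..<m} \<rightarrow> {..<m}" "represents n m ix f T"
    and wf: "wf_fm {..<n} {..<m} \<phi>"
  then interpret truth_table n m ix f T
    by unfold_locales
  show "\<forall>(R, P)\<in>states {..<n} {..<m}.
      val (model_check T \<phi>) (profile_index n m ix R, profile_index n m ix P) \<longleftrightarrow>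
      sat {..<n} {..<m} f (R, P) \<phi>"
    using val_model_check[OF wf] by (auto simp: states_def)
  \<comment> \<open>The unknown left by \<open>exI\<close> precedes all fixed variables, so only a
    closed term can fill it; this makes the constant uniform.\<close>
  show "cost (model_check T \<phi>) \<le> 29 * (fm_length \<phi> * fact m ^ (2 * n + max_coalition \<phi>))"
    by (rule cost_model_check_le)
next
  fix n m ix f T
  assume "n \<ge> 1" "f \<in> profiles {..<n} {..<m} \<rightarrow> {..<m}" "represents n m ix f T"
  then interpret truth_table n m ix f T
    by unfold_locales
  show "val (check_sp T) \<longleftrightarrow> strategy_proof {..<n} {..<m} f"
    by (rule val_check_sp)
  show "cost (check_sp T) \<le> 24 * (n * fact m ^ (n + 1))"
    by (rule cost_check_sp_le)
next
  fix n m ix f T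
  assume "n \<ge> 1" "f \<in> profiles {..<n} {..<m} \<rightarrow> {..<m}" "represents n m ix f T"
  then interpret truth_table n m ix f T
    by unfold_locales
  show "val (check_sgsp T) \<longleftrightarrow> strongly_group_strategy_proof {..<n} {..<m} f"
    by (rule val_check_sgsp)
  show "cost (check_sgsp T) \<le> 36 * (n * fact m ^ n * (1 + fact m) ^ n)"
    by (rule cost_check_sgsp_le)
qed

end
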